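(* Let $n\ge 2$ and let $(D_\ell)_{\ell\geq 1}$ be a sequence of $n\times n$ doubly stochastic matrices. If \[ \sum_{\ell=1}^\infty \big(1-\sigma_2(D_\ell)\big) = +\infty, \] where $\sigma_2(D_\ell)$ denotes the second largest singular value of $D_\ell$, then \[ \lim_{m\to\infty} D_1D_2\cdots D_m = J_n . \]
   Context: An $n\times n$ matrix is doubly stochastic if all its entries are nonnegative real numbers and each row and each column sums to $1$. $J_n$ denotes the $n\times n$ matrix all of whose entries equal $1/n$. The singular values of a matrix $D$ are the square roots of the eigenvalues of $D^{\intercal}D$, listed with multiplicity in nonincreasing order $\sigma_1(D)\ge\sigma_2(D)\ge\cdots\ge\sigma_n(D)$; the second largest singular value is $\sigma_2(D)$ (so it may equal $\sigma_1(D)=1$). *)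

theory Defs
  imports "HOL-Analysis.Analysis" "HOL-Computational_Algebra.Polynomial"
begin

definition doubly_stochastic :: "real ^ 'n ^ 'n \<Rightarrow> bool" where
  "doubly_stochastic A \<longleftrightarrow>
     (\<forall>i j. 0 \<le> A $ i $ j) \<and>
     (\<forall>i. (\<Sum>j\<in>UNIV. A $ i $ j) = 1) \<and>
     (\<forall>j. (\<Sum>i\<in>UNIV. A $ i $ j) = 1)"

definition J_mat :: "real ^ 'n ^ 'n" where
  "J_mat = (\<chi> i j. 1 / real CARD('n))"

text \<open>The characteristic polynomial \<open>det (X I - A)\<close>, a determinant over the polynomial ring.\<close>

definition charpoly :: "'a::comm_ring_1 ^ 'n ^ 'n \<Rightarrow> 'a poly" where
  "charpoly A = det (\<chi> i j. (if i = j then [:0, 1:] else 0) - [:A $ i $ j:])"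

text \<open>
  Singular values in nonincreasing order.  Since \<open>D\<^sup>T D\<close> is symmetric positive
  semidefinite, its characteristic polynomial has only real, nonnegative roots, so that the list
  of square roots of its real roots, with multiplicity, has length \<open>CARD('n)\<close>.
\<close>

definition singular_values :: "real ^ 'n ^ 'n \<Rightarrow> real list" where
  "singular_values D =
     rev (sorted_list_of_multiset (image_mset sqrt (proots (charpoly (transpose D ** D)))))"

text \<open>The numbering of the singular values starts at 1, whereas list positions start at 0.\<close>

definition singular_value :: "nat \<Rightarrow> real ^ 'n ^ 'n \<Rightarrow> real" where
  "singular_value k D = singular_values D ! (k - 1)"

text \<open>
  \<open>mat_prod D m\<close> is the matrix product \<open>D 1 ** D 2 ** \<dots> ** D m\<close>, in this order.  The generic
  product operators cannot be used, since \<open>(*)\<close> on vectors and matrices is componentwise.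
\<close>

primrec mat_prod :: "(nat \<Rightarrow> real ^ 'n ^ 'n) \<Rightarrow> nat \<Rightarrow> real ^ 'n ^ 'n" where
  "mat_prod D 0 = mat 1"
| "mat_prod D (Suc m) = mat_prod D m ** D (Suc m)"

end

theory Submission
  imports Defs
begin

text \<open>
  A doubly stochastic \<open>D\<close> fixes the all-ones vector and maps its orthogonal complement into itself,
  contracting norms there by the factor \<open>\<sigma>\<^sub>2(D)\<close>: a maximiser of the Rayleigh quotient of
  \<open>D\<^sup>T D\<close> on the complement is an eigenvector, and together with the all-ones vector
  (eigenvalue 1) it accounts for two roots, counted with multiplicity, of the characteristic polynomial.
  So \<open>D\<^sub>1 \<dots> D\<^sub>m\<close> shrinks the complement by \<open>\<Prod> \<sigma>\<^sub>2(D\<^sub>l) \<le> exp (- \<Sum> (1 - \<sigma>\<^sub>2(D\<^sub>l)))\<close>,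
  which tends to 0.
\<close>

section \<open>Linear factors and roots of the characteristic polynomial\<close>

lemma poly_charpoly:
  fixes A :: "'a::comm_ring_1 ^ 'n ^ 'n"
  shows "poly (charpoly A) x = det (mat x - A)"
  unfolding charpoly_def det_def
  by (auto simp: poly_sum poly_prod mat_def if_distrib[of "\<lambda>p. poly p x"] cong: if_cong)

lemma det_const_poly:
  fixes E :: "'a::comm_ring_1 ^ 'n ^ 'n"
  shows "det (\<chi> i j. [:E $ i $ j:]) = [:det E:]"
proof -
  have prod: "(\<Prod>i\<in>S. [:f i:]) = [:\<Prod>i\<in>S. f i:]" if "finite S" for f :: "'n \<Rightarrow> 'a" and S
    using that by induction (auto simp: one_pCons)
  have sum: "(\<Sum>i\<in>S. [:f i:]) = [:\<Sum>i\<in>S. f i:]" if "finite S"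
    for f :: "('n \<Rightarrow> 'n) \<Rightarrow> 'a" and S
    using that by induction auto
  show ?thesis
    unfolding det_def by (simp add: prod sum of_int_poly finite_permutations mult.commute)
qed

text \<open>Let \<open>E\<close> be the identity with rows \<open>i\<close>, \<open>j\<close>
  replaced by \<open>u\<close>, \<open>v\<close>. Rows \<open>i\<close>, \<open>j\<close> of
  \<open>E (X I - A)\<close> are then multiples of \<open>X - \<kappa>\<close> and
  \<open>X - \<mu>\<close>, so both factors leave the determinant \<open>det E * charpoly A\<close>.
  The case \<open>\<kappa> = \<mu>\<close> is included and yields a double root.\<close>

lemma two_left_eigenvectors_charpoly_dvd:
  fixes A :: "real ^ 'n ^ 'n"
  assumes u: "u v* A = \<kappa> *\<^sub>R u" and v: "v v* A = \<mu> *\<^sub>R v"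
    and ind: "u $ i * v $ j \<noteq> u $ j * v $ i"
  shows "[:-\<kappa>, 1:] * [:-\<mu>, 1:] dvd charpoly A"
proof -
  define E :: "real ^ 'n ^ 'n" where
    "E = (\<chi> r. if r = i then u else if r = j then v else axis r 1)"
  define M :: "real poly ^ 'n ^ 'n" where
    "M = (\<chi> i j. (if i = j then [:0, 1:] else 0) - [:A $ i $ j:])"
  define E' :: "real poly ^ 'n ^ 'n" where "E' = (\<chi> i j. [:E $ i $ j:])"
  define U V :: "real poly ^ 'n" where "U = (\<chi> k. [:u $ k:])" and "V = (\<chi> k. [:v $ k:])"
  have ij: "i \<noteq> j"
    using ind by auto
  have const_sum: "(\<Sum>k\<in>UNIV. [:f k:]) = [:\<Sum>k\<in>UNIV. f k:]" for f :: "'n \<Rightarrow> real"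
  proof -
    have "(\<Sum>k\<in>S. [:f k:]) = [:\<Sum>k\<in>S. f k:]" if "finite S" for S
      using that by induction auto
    then show ?thesis
      by simp
  qed
  have row: "(\<Sum>k\<in>UNIV. [:w $ k:] * M $ k $ c) = [:-\<nu>, 1:] * [:w $ c:]"
    if w: "w v* A = \<nu> *\<^sub>R w" for w \<nu> c
  proof -
    have "(\<Sum>k\<in>UNIV. w $ k * A $ k $ c) = \<nu> * w $ c"
      using arg_cong[OF w, of "\<lambda>z. z $ c"] by (simp add: vector_matrix_mult_def mult.commute)
    moreover have "(\<Sum>k\<in>UNIV. [:w $ k:] * M $ k $ c) =
        (\<Sum>k\<in>UNIV. (if k = c then [:0, w $ k:] else 0) - [:w $ k * A $ k $ c:])"
      by (intro sum.cong) (auto simp: M_def)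
    ultimately show ?thesis
      by (simp add: sum_subtractf const_sum mult.commute)
  qed
  define B where "B = E' ** M"
  have "B = (\<chi> r. if r = i then [:-\<kappa>, 1:] *s U else if r = j then [:-\<mu>, 1:] *s V else B $ r)"
    using row[OF u] row[OF v] ij
    by (auto simp: vec_eq_iff matrix_matrix_mult_def B_def E'_def E_def U_def V_def)
  then have "det B =
      det (\<chi> r. if r = i then [:-\<kappa>, 1:] *s U else if r = j then [:-\<mu>, 1:] *s V else B $ r)"
    by (rule arg_cong)
  also have "\<dots> = [:-\<kappa>, 1:] *
      det (\<chi> r. if r = i then U else if r = j then [:-\<mu>, 1:] *s V else B $ r)"
    by (rule det_row_mul)
  \<comment> \<open>Reordering the conditionals brings row \<open>j\<close> into the form that
    \<open>det_row_mul\<close> expects.\<close>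
  also have "(\<chi> r. if r = i then U else if r = j then [:-\<mu>, 1:] *s V else B $ r) =
      (\<chi> r. if r = j then [:-\<mu>, 1:] *s V else if r = i then U else B $ r)"
    using ij by (auto simp: vec_eq_iff)
  also have "det \<dots> = [:-\<mu>, 1:] *
      det (\<chi> r. if r = j then V else if r = i then U else B $ r)"
    by (rule det_row_mul)
  finally have "[:-\<kappa>, 1:] * [:-\<mu>, 1:] dvd det B"
    by (simp only: mult.assoc[symmetric] dvd_triv_left)
  also have "det B = smult (det E) (charpoly A)"
    by (simp add: B_def det_mul E'_def det_const_poly charpoly_def M_def)
  finally have dvd: "[:-\<kappa>, 1:] * [:-\<mu>, 1:] dvd smult (det E) (charpoly A)" .
  \<comment> \<open>The axis rows of \<open>E\<close> confine the support of \<open>x\<close> to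
    \<open>{i, j}\<close>; what remains is a 2 by 2 system whose determinant is nonzero by
    \<open>ind\<close>.\<close>
  have "x = 0" if x: "E *v x = 0" for x
  proof -
    have comp: "E $ r \<bullet> x = 0" for r
      using x by (metis matrix_vector_mul_component zero_index)
    have other: "x $ r = 0" if "r \<noteq> i" "r \<noteq> j" for r
      using comp[of r] that by (simp add: E_def inner_axis')
    have two: "w \<bullet> x = w $ i * x $ i + w $ j * x $ j" for w
    proof -
      have "w \<bullet> x = (\<Sum>k\<in>{i, j}. w $ k * x $ k)"
        unfolding inner_vec_def using other by (intro sum.mono_neutral_cong_right) auto
      then show ?thesis
        using ij by simp
    qed
    have a: "u $ i * x $ i + u $ j * x $ j = 0"
      using comp[of i] two[of u] by (simp add: E_def)
    have b: "v $ i * x $ i + v $ j * x $ j = 0"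
      using comp[of j] two[of v] ij by (simp add: E_def)
    have "(u $ i * v $ j - u $ j * v $ i) * x $ i = 0"
      using a b by algebra
    moreover have "(u $ i * v $ j - u $ j * v $ i) * x $ j = 0"
      using a b by algebra
    ultimately have "x $ i = 0" "x $ j = 0"
      using ind by auto
    then show ?thesis
      using other by (metis vec_eq_iff zero_index)
  qed
  then have "det E \<noteq> 0"
    by (metis invertible_det_nz invertible_left_inverse matrix_left_invertible_ker)
  then show ?thesis
    using dvd by (simp add: dvd_smult_iff)
qed

lemma proots_two_factors:
  fixes p :: "real poly"
  assumes "[:-a, 1:] * [:-b, 1:] dvd p" "p \<noteq> 0"
  shows "{#a, b#} \<subseteq># proots p"
proof -
  obtain q where q: "p = [:-a, 1:] * [:-b, 1:] * q"
    using assms(1) by (elim dvdE)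
  then have "q \<noteq> 0"
    using assms(2) by auto
  have "proots p = proots [:-a, 1:] + proots [:-b, 1:] + proots q"
    unfolding q using \<open>q \<noteq> 0\<close> by (simp add: proots_mult del: mult_pCons_left mult_pCons_right)
  then show ?thesis
    by simp
qed

text \<open>If position 1 held a value below \<open>b\<close>, so would all later positions, leaving
  only the head to be at least \<open>b\<close>; but \<open>a\<close> and \<open>b\<close> count as
  two such entries, even when equal.\<close>

lemma second_largest_ge:
  fixes xs :: "'a::linorder list"
  assumes "sorted (rev xs)" "{#a, b#} \<subseteq># mset xs" "b \<le> a"
  shows "b \<le> xs ! 1"
proof (rule ccontr)
  assume less: "\<not> b \<le> xs ! 1"
  have "size {#a, b#} \<le> length xs"
    using size_mset_mono[OF assms(2)] by simp
  then obtain x y zs where xs: "xs = x # y # zs"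
    by (cases xs; cases "tl xs") auto
  have "z < b" if "z \<in> set (y # zs)" for z
    using that assms(1) less by (auto simp: xs sorted_append)
  then have none: "filter_mset (\<lambda>z. b \<le> z) (mset (y # zs)) = {#}"
    by (force simp: not_le)
  have "{#a, b#} \<subseteq># filter_mset (\<lambda>z. b \<le> z) (mset xs)"
    using multiset_filter_mono[OF assms(2), of "\<lambda>z. b \<le> z"] assms(3) by simp
  then have "2 \<le> size (filter_mset (\<lambda>z. b \<le> z) (mset xs))"
    using size_mset_mono by fastforce
  then show False
    using none by (simp add: xs split: if_splits)
qed

section \<open>Doubly stochastic matrices as contractions fixing the all-ones vector
  \<open>1\<close>\<close>

lemma doubly_stochastic_one:
  assumes "doubly_stochastic D"
  shows "D *v 1 = 1" "1 v* D = 1"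
  using assms by (auto simp: doubly_stochastic_def vec_eq_iff matrix_vector_mult_def vector_matrix_mult_def)

lemma inner_matrix_vector:
  fixes A :: "real ^ 'n ^ 'm"
  shows "(A *v x) \<bullet> y = x \<bullet> (y v* A)"
  by (metis dot_lmul_matrix inner_commute)

lemma doubly_stochastic_inner_one:
  assumes "doubly_stochastic D" "x \<bullet> 1 = 0"
  shows "(D *v x) \<bullet> 1 = 0"
  using assms by (simp add: inner_matrix_vector doubly_stochastic_one)

text \<open>Each row is a probability distribution, so convexity of the square bounds each entry of
  \<open>D *v x\<close>; after exchanging the sums, the column sums give back the norm of
  \<open>x\<close>.\<close>

lemma doubly_stochastic_norm_le:
  assumes "doubly_stochastic D"
  shows "norm (D *v x) \<le> norm x"
proof -
  have nonneg: "0 \<le> D $ i $ j" and rows: "(\<Sum>j\<in>UNIV. D $ i $ j) = 1"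
    and cols: "(\<Sum>i\<in>UNIV. D $ i $ j) = 1" for i j
    using assms by (auto simp: doubly_stochastic_def)
  \<comment> \<open>Jensen's inequality: the variance of \<open>x\<close> under the distribution \<open>D $ i\<close> is nonnegative.\<close>
  have row: "((D *v x) $ i)\<^sup>2 \<le> (\<Sum>j\<in>UNIV. D $ i $ j * (x $ j)\<^sup>2)" for i
  proof -
    define m where "m = (\<Sum>j\<in>UNIV. D $ i $ j * x $ j)"
    have "0 \<le> (\<Sum>j\<in>UNIV. D $ i $ j * (x $ j - m)\<^sup>2)"
      using nonneg by (simp add: sum_nonneg)
    also have "\<dots> = (\<Sum>j\<in>UNIV. D $ i $ j * (x $ j)\<^sup>2 - 2 * m * (D $ i $ j * x $ j) + m\<^sup>2 * D $ i $ j)"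
      by (intro sum.cong) (auto simp: power2_eq_square algebra_simps)
    also have "\<dots> = (\<Sum>j\<in>UNIV. D $ i $ j * (x $ j)\<^sup>2) - 2 * m * m + m\<^sup>2"
      by (simp add: sum.distrib sum_subtractf rows m_def flip: sum_distrib_left)
    finally show ?thesis
      by (simp add: matrix_vector_mult_def m_def power2_eq_square)
  qed
  have "(norm (D *v x))\<^sup>2 = (\<Sum>i\<in>UNIV. ((D *v x) $ i)\<^sup>2)"
    by (simp add: norm_vec_def L2_set_def sum_nonneg)
  also have "\<dots> \<le> (\<Sum>i\<in>UNIV. \<Sum>j\<in>UNIV. D $ i $ j * (x $ j)\<^sup>2)"
    by (intro sum_mono row)
  also have "\<dots> = (\<Sum>j\<in>UNIV. \<Sum>i\<in>UNIV. D $ i $ j * (x $ j)\<^sup>2)"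
    by (rule sum.swap)
  also have "\<dots> = (norm x)\<^sup>2"
    by (simp add: norm_vec_def L2_set_def sum_nonneg cols flip: sum_distrib_right)
  finally show ?thesis
    by (rule power2_le_imp_le) simp
qed

text \<open>It suffices to find one point that is not a root. By the contraction property
  \<open>transpose D ** D\<close> has no eigenvalue above 1, so 2 is such a point.\<close>

lemma doubly_stochastic_charpoly_nonzero:
  assumes "doubly_stochastic D"
  shows "charpoly (transpose D ** D) \<noteq> 0"
proof -
  have "x = 0" if "(mat 2 - transpose D ** D) *v x = 0" for x
  proof -
    have "(D *v x) v* D = 2 *\<^sub>R x"
    proof -
      have "mat 2 *v x = 2 *\<^sub>R x"
        by (simp add: vec_eq_iff matrix_vector_mult_def mat_def if_distrib if_distribR cong: if_cong)
      then show ?thesis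
        using that by (simp add: matrix_vector_mult_diff_rdistrib flip: matrix_vector_mul_assoc)
    qed
    then have "(norm (D *v x))\<^sup>2 = 2 * (norm x)\<^sup>2"
      by (simp add: power2_norm_eq_inner inner_matrix_vector)
    moreover have "(norm (D *v x))\<^sup>2 \<le> (norm x)\<^sup>2"
      using doubly_stochastic_norm_le[OF assms] by (simp add: power_mono)
    ultimately show ?thesis
      by simp
  qed
  then have "det (mat 2 - transpose D ** D) \<noteq> 0"
    by (metis invertible_det_nz invertible_left_inverse matrix_left_invertible_ker)
  then show ?thesis
    by (metis poly_0 poly_charpoly)
qed

section \<open>The second singular value as contraction factor\<close>

lemma doubly_stochastic_second_eigenvector:
  fixes D :: "real ^ 'n ^ 'n"
  assumes card: "CARD('n) \<ge> 2" and D: "doubly_stochastic D"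
  obtains v \<mu> where "v \<bullet> 1 = 0" "v \<noteq> 0" "(D *v v) v* D = \<mu> *\<^sub>R v" "0 \<le> \<mu>" "\<mu> \<le> 1"
    "\<And>x. x \<bullet> 1 = 0 \<Longrightarrow> (norm (D *v x))\<^sup>2 \<le> \<mu> * (norm x)\<^sup>2"
proof -
  define S :: "(real ^ 'n) set" where "S = sphere 0 1 \<inter> {x. 1 \<bullet> x = 0}"
  obtain i j :: 'n where "i \<noteq> j"
    using card by (metis card_2_iff' card_le_Suc0_iff_eq finite_code iso_tuple_UNIV_I not_less_eq_eq numeral_2_eq_2)
  \<comment> \<open>A nonzero vector of the complement, making \<open>S\<close> nonempty; it exists
    because the dimension is at least 2.\<close>
  define w :: "real ^ 'n" where "w = axis i 1 - axis j 1"
  have "w $ i = 1"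
    using \<open>i \<noteq> j\<close> by (simp add: w_def axis_def)
  then have "w \<noteq> 0"
    by auto
  moreover have "1 \<bullet> w = 0"
    by (simp add: w_def inner_diff_right inner_axis)
  ultimately have "w /\<^sub>R norm w \<in> S"
    by (simp add: S_def)
  moreover have "compact S"
    unfolding S_def by (intro compact_Int_closed closed_hyperplane) simp
  moreover have "continuous_on S (\<lambda>x. (norm (D *v x))\<^sup>2)"
    by (intro continuous_intros)
  ultimately obtain v where v: "v \<in> S"
    and max: "\<And>x. x \<in> S \<Longrightarrow> (norm (D *v x))\<^sup>2 \<le> (norm (D *v v))\<^sup>2"
    using continuous_attains_sup by (metis empty_iff)
  define \<mu> where "\<mu> = (norm (D *v v))\<^sup>2"
  have nv: "norm v = 1" and v1: "v \<bullet> 1 = 0"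
    using v by (auto simp: S_def inner_commute)
  have bound: "(norm (D *v x))\<^sup>2 \<le> \<mu> * (norm x)\<^sup>2" if "x \<bullet> 1 = 0" for x
  proof (cases "x = 0")
    case False
    then have "x /\<^sub>R norm x \<in> S"
      using that by (simp add: S_def inner_commute)
    from max[OF this] False show ?thesis
      by (simp add: \<mu>_def matrix_vector_mult_scaleR power_mult_distrib field_simps)
  qed simp
  \<comment> \<open>The residual of the eigenvector equation. It lies in the complement, so
    \<open>bound\<close> applies to every \<open>v + t *\<^sub>R y\<close>.\<close>
  define y where "y = \<mu> *\<^sub>R v - (D *v v) v* D"
  have y1: "y \<bullet> 1 = 0"
    using v1 D by (simp add: y_def inner_diff_left dot_lmul_matrix doubly_stochastic_one doubly_stochastic_inner_one)
  \<comment> \<open>The form \<open>\<mu> \<parallel>x\<parallel>\<^sup>2 - \<parallel>D x\<parallel>\<^sup>2\<close> is positive semidefinite on the complement and vanishes at \<open>v\<close>,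
    so its derivative at \<open>v\<close> in the direction \<open>y\<close>, which is \<open>2 (y \<bullet> y)\<close>, is zero.\<close>
  define c where "c = \<mu> * (norm y)\<^sup>2 - (norm (D *v y))\<^sup>2"
  have quad: "0 \<le> 2 * t * (y \<bullet> y) + t\<^sup>2 * c" for t
  proof -
    have "(v + t *\<^sub>R y) \<bullet> 1 = 0"
      using v1 y1 by (simp add: inner_add_left)
    from bound[OF this]
    have "0 \<le> \<mu> * (norm (v + t *\<^sub>R y))\<^sup>2 - (norm (D *v v + t *\<^sub>R (D *v y)))\<^sup>2"
      by (simp add: matrix_vector_right_distrib matrix_vector_mult_scaleR)
    also have "\<dots> = \<mu> * (v \<bullet> v) - (D *v v) \<bullet> (D *v v)
        + 2 * t * (\<mu> * (v \<bullet> y) - (D *v v) \<bullet> (D *v y)) + t\<^sup>2 * c"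
      by (simp add: c_def power2_norm_eq_inner inner_add_left inner_add_right inner_commute algebra_simps)
         (simp add: power2_eq_square)
    also have "\<mu> * (v \<bullet> v) - (D *v v) \<bullet> (D *v v) = 0"
      using nv by (simp add: \<mu>_def flip: power2_norm_eq_inner)
    also have "(D *v v) \<bullet> (D *v y) = ((D *v v) v* D) \<bullet> y"
      by (simp add: dot_lmul_matrix)
    also have "\<mu> * (v \<bullet> y) - ((D *v v) v* D) \<bullet> y = y \<bullet> y"
      by (simp add: y_def inner_diff_left)
    finally show ?thesis
      by simp
  qed
  have "y \<bullet> y = 0"
  proof (rule ccontr)
    assume "y \<bullet> y \<noteq> 0"
    then have pos: "y \<bullet> y > 0"
      by simp
    \<comment> \<open>A small negative \<open>t\<close> for which the quadratic term cancels at most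
      half of the negative linear term; the \<open>+ 1\<close> keeps the denominator positive when
      \<open>c = 0\<close>.\<close>
    define t where "t = - (y \<bullet> y) / (\<bar>c\<bar> + 1)"
    have "t < 0"
      using pos by (simp add: t_def divide_neg_pos)
    have "t\<^sup>2 * c \<le> t\<^sup>2 * (\<bar>c\<bar> + 1)"
      by (intro mult_left_mono) auto
    also have "\<dots> = - (t * (y \<bullet> y))"
      by (simp add: t_def power2_eq_square)
    finally have "2 * t * (y \<bullet> y) + t\<^sup>2 * c \<le> t * (y \<bullet> y)"
      by simp
    moreover have "t * (y \<bullet> y) < 0"
      using \<open>t < 0\<close> pos by (simp add: mult_neg_pos)
    ultimately show False
      using quad[of t] by simp
  qed
  then have "(D *v v) v* D = \<mu> *\<^sub>R v"
    by (simp add: y_def)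
  moreover have "\<mu> \<le> 1"
    using doubly_stochastic_norm_le[OF D, of v] nv by (simp add: \<mu>_def power_le_one)
  moreover have "v \<noteq> 0" "0 \<le> \<mu>"
    using nv by (auto simp: \<mu>_def)
  ultimately show thesis
    using that v1 bound by blast
qed

text \<open>The roots 1 and \<open>\<mu>\<close>, with \<open>\<mu> \<le> 1\<close>, force the
  second entry of the nonincreasing list of singular values to be at least
  \<open>sqrt \<mu>\<close>, which bounds the contraction on the complement.\<close>

lemma doubly_stochastic_contraction:
  fixes D :: "real ^ 'n ^ 'n"
  assumes card: "CARD('n) \<ge> 2" and D: "doubly_stochastic D"
  shows "0 \<le> singular_value 2 D"
    and "x \<bullet> 1 = 0 \<Longrightarrow> norm (D *v x) \<le> singular_value 2 D * norm x"
proof -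
  obtain v \<mu> where v1: "v \<bullet> 1 = 0" and "v \<noteq> 0"
    and eig: "(D *v v) v* D = \<mu> *\<^sub>R v" and \<mu>: "0 \<le> \<mu>" "\<mu> \<le> 1"
    and bound: "\<And>x. x \<bullet> 1 = 0 \<Longrightarrow> (norm (D *v x))\<^sup>2 \<le> \<mu> * (norm x)\<^sup>2"
    using doubly_stochastic_second_eigenvector[OF assms] by blast
  have left: "x v* (transpose D ** D) = (D *v x) v* D" for x
    by (simp flip: vector_matrix_mul_assoc)
  \<comment> \<open>A constant vector orthogonal to \<open>1\<close> vanishes, so \<open>v\<close>
    is not constant. Two differing entries give the nonzero minor that shows \<open>1\<close> and
    \<open>v\<close> independent.\<close>
  obtain i j where "v $ i \<noteq> v $ j"
  proof (rule ccontr)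
    assume "\<not> thesis"
    then have eq: "v $ i = v $ j" for i j
      using that by blast
    obtain k :: 'n where True
      by simp
    have "v = v $ k *\<^sub>R 1"
      unfolding vec_eq_iff using eq by simp
    then have "v \<bullet> v = 0"
      using v1 inner_scaleR_right[of v "v $ k" 1] by simp
    then have "v = 0"
      by simp
    then show False
      using \<open>v \<noteq> 0\<close> by simp
  qed
  then have "[:- 1, 1:] * [:- \<mu>, 1:] dvd charpoly (transpose D ** D)"
    using eig D by (intro two_left_eigenvectors_charpoly_dvd[of 1 _ _ v _ i j])
      (auto simp: left doubly_stochastic_one)
  then have "{#1, \<mu>#} \<subseteq># proots (charpoly (transpose D ** D))"
    using D by (intro proots_two_factors doubly_stochastic_charpoly_nonzero)
  from image_mset_subseteq_mono[OF this, of sqrt]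
  have "{#1, sqrt \<mu>#} \<subseteq># mset (singular_values D)"
    by (simp add: singular_values_def)
  moreover have "sorted (rev (singular_values D))"
    by (simp add: singular_values_def)
  ultimately have ge: "sqrt \<mu> \<le> singular_value 2 D"
    using second_largest_ge[of "singular_values D" 1 "sqrt \<mu>"] \<mu> by (simp add: singular_value_def)
  then show "0 \<le> singular_value 2 D"
    using \<mu> by (meson order_trans real_sqrt_ge_zero)
  assume "x \<bullet> 1 = 0"
  then have "norm (D *v x) \<le> sqrt (\<mu> * (norm x)\<^sup>2)"
    using bound by (intro real_le_rsqrt)
  also have "\<dots> = sqrt \<mu> * norm x"
    by (simp add: real_sqrt_mult)
  also have "\<dots> \<le> singular_value 2 D * norm x"
    using ge by (intro mult_right_mono) auto
  finally show "norm (D *v x) \<le> singular_value 2 D * norm x" .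
qed

section \<open>Products of doubly stochastic matrices and their limit\<close>

lemma mat_prod_one:
  assumes "\<And>l. l \<ge> 1 \<Longrightarrow> doubly_stochastic (D l)"
  shows "mat_prod D m *v 1 = 1"
  by (induction m) (simp_all add: assms doubly_stochastic_one flip: matrix_vector_mul_assoc)

text \<open>The last factor acts on \<open>x\<close> first and keeps it in the complement, so the
  induction hypothesis is applied to \<open>D (Suc m) *v x\<close>; hence the generalisation over
  \<open>x\<close>.\<close>

lemma mat_prod_norm_le:
  fixes D :: "nat \<Rightarrow> real ^ 'n ^ 'n"
  assumes card: "CARD('n) \<ge> 2" and D: "\<And>l. l \<ge> 1 \<Longrightarrow> doubly_stochastic (D l)"
  shows "x \<bullet> 1 = 0 \<Longrightarrow> norm (mat_prod D m *v x) \<le> (\<Prod>l=1..m. singular_value 2 (D l)) * norm x"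
proof (induction m arbitrary: x)
  case (Suc m)
  let ?y = "D (Suc m) *v x"
  have ds: "doubly_stochastic (D (Suc m))"
    by (simp add: D)
  have "norm (mat_prod D (Suc m) *v x) = norm (mat_prod D m *v ?y)"
    by (simp add: matrix_vector_mul_assoc)
  also have "\<dots> \<le> (\<Prod>l=1..m. singular_value 2 (D l)) * norm ?y"
    using Suc.prems ds by (intro Suc.IH doubly_stochastic_inner_one)
  also have "\<dots> \<le> (\<Prod>l=1..m. singular_value 2 (D l)) * (singular_value 2 (D (Suc m)) * norm x)"
    using Suc.prems ds card D
    by (intro mult_left_mono prod_nonneg doubly_stochastic_contraction) auto
  finally show ?case
    by (simp add: mult.assoc)
qed simp

theorem theorem3p5:
  fixes D :: "nat \<Rightarrow> real ^ 'n ^ 'n"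
  assumes "CARD('n) \<ge> 2"
    and "\<And>l. l \<ge> 1 \<Longrightarrow> doubly_stochastic (D l)"
    and "filterlim (\<lambda>m. \<Sum>l=1..m. (1 - singular_value 2 (D l))) at_top sequentially"
  shows "(\<lambda>m. mat_prod D m) \<longlonglongrightarrow> J_mat"
proof -
  let ?\<sigma> = "\<lambda>l. singular_value 2 (D l)"
  \<comment> \<open>Factorwise this is \<open>1 + s \<le> exp s\<close> with
    \<open>s = ?\<sigma> l - 1\<close>; the bounds multiply because the singular values are
    nonnegative.\<close>
  have prod_le: "(\<Prod>l=1..m. ?\<sigma> l) \<le> exp (- (\<Sum>l=1..m. 1 - ?\<sigma> l))" for m
  proof -
    have "(\<Prod>l=1..m. ?\<sigma> l) \<le> (\<Prod>l=1..m. exp (- (1 - ?\<sigma> l)))"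
      using exp_ge_add_one_self[of "- (1 - ?\<sigma> l)" for l] doubly_stochastic_contraction(1)[OF assms(1)] assms(2)
      by (intro prod_mono) auto
    then show ?thesis
      by (simp add: exp_sum sum_negf[symmetric] del: minus_diff_eq)
  qed
  have exp0: "(\<lambda>m. exp (- (\<Sum>l=1..m. 1 - ?\<sigma> l))) \<longlonglongrightarrow> 0"
    using assms(3)
    by (intro filterlim_compose[OF exp_at_bot] filterlim_compose[OF filterlim_uminus_at_bot_at_top])
  have entry: "(\<lambda>m. mat_prod D m $ i $ j) \<longlonglongrightarrow> 1 / real CARD('n)" for i j
  proof -
    \<comment> \<open>The projection of the \<open>j\<close>-th basis vector onto the complement.
      Since the products fix \<open>1\<close>, applying them to \<open>z\<close> gives exactly the
      deviation of column \<open>j\<close> from its limit.\<close>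
    define z :: "real ^ 'n" where "z = axis j 1 - (1 / real CARD('n)) *\<^sub>R 1"
    have z1: "z \<bullet> 1 = 0"
      by (simp add: z_def inner_diff_left inner_axis') (simp add: inner_vec_def)
    have diff: "mat_prod D m $ i $ j - 1 / real CARD('n) = (mat_prod D m *v z) $ i" for m
      by (simp add: z_def matrix_vector_mult_diff_distrib matrix_vector_mult_scaleR
          mat_prod_one[OF assms(2)] matrix_vector_mul_component inner_axis)
    have bound: "\<bar>(mat_prod D m *v z) $ i\<bar> \<le> exp (- (\<Sum>l=1..m. 1 - ?\<sigma> l)) * norm z" for m
      by (rule order_trans[OF component_le_norm_cart order_trans[OF mat_prod_norm_le[OF assms(1,2) z1]]])
         (assumption | intro mult_right_mono prod_le norm_ge_zero)+
    have "(\<lambda>m. mat_prod D m $ i $ j - 1 / real CARD('n)) \<longlonglongrightarrow> 0"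
      by (rule Lim_null_comparison[OF _ tendsto_mult_left_zero[OF exp0, of "norm z"]])
         (simp only: diff bound real_norm_def eventually_True)
    then show ?thesis
      by (rule LIM_zero_cancel)
  qed
  show ?thesis
    unfolding J_mat_def by (intro vec_tendstoI) (simp add: entry)
qed

end
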